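(* Let $n\ge1$. Each of the following statistics on $S_n$ is homomesic for permutations with rotation, with the indicated average over every orbit of $rot$ on $S_n$: (1) the depth $\sum_{i:\,\pi(i)>i}(\pi(i)-i)$ (average $\frac1n\binom{n+1}{3}$); (2) the inversion sum (average $\frac12\binom{n+1}{3}$); (3) the non-inversion sum (average $\frac12\binom{n+1}{3}$); (4) the Spearman's rho of the permutation and the identity permutation, $\sum_{i\in[n]}(\pi(i)-i)^2$ (average $\binom{n+1}{3}$); (5) the total displacement $\sum_{i\in[n]}|\pi(i)-i|$ (average $\frac2n\binom{n+1}{3}$).
   Context: $[n]=\{1,\dots,n\}$ and $S_n$ is the set of permutations of $[n]$, written in one-line notation $\pi=\pi(1)\pi(2)\cdots\pi(n)$. The rotation map $rot:S_n\to S_n$ sends $\pi(1)\pi(2)\cdots\pi(n)$ to $\pi(2)\cdots\pi(n)\pi(1)$. For a bijection $\varphi:S_n\to S_n$, the orbits are the sets $\{\varphi^m(\pi)\}$ of permutations obtained by applying $\varphi$ any number of times. A statistic $st$ is homomesic with average $c$ for $\varphi$ if $\frac{1}{\#\mathcal{O}}\sum_{x\in\mathcal{O}}st(x)=c$ for every orbit $\mathcal{O}$. An inversion of $\pi$ is a pair $i<j$ in $[n]$ with $\pi(j)<\pi(i)$; a non-inversion is a pair $i<j$ with $\pi(i)<\pi(j)$. The inversion sum (resp. non-inversion sum) of $\pi$ is $\sum(j-i)$ over all inversions (resp. non-inversions) $i<j$ of $\pi$. *)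

theory Defs
  imports Complex_Main "HOL-Combinatorics.Permutations"
begin

definition orbits :: "('a \<Rightarrow> 'a) \<Rightarrow> 'a set \<Rightarrow> 'a set set" where
  "orbits \<phi> S = (\<lambda>x. {(\<phi> ^^ m) x | m. True}) ` S"

text \<open>Intended for a bijection \<open>\<phi>\<close> of a finite set \<open>S\<close> onto itself, so that the orbits are
  finite and partition \<open>S\<close>; see \<open>bij_betw_rot\<close> below for the instance used here.\<close>

definition homomesic :: "('a \<Rightarrow> 'a) \<Rightarrow> 'a set \<Rightarrow> ('a \<Rightarrow> real) \<Rightarrow> real \<Rightarrow> bool" where
  "homomesic \<phi> S st c \<longleftrightarrow>
     (\<forall>\<O>\<in>orbits \<phi> S. (1 / real (card \<O>)) * (\<Sum>x\<in>\<O>. st x) = c)"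

definition perms :: "nat \<Rightarrow> (nat \<Rightarrow> nat) set" where
  "perms n = {\<pi>. \<pi> permutes {1..n}}"

text \<open>For \<open>i \<in> {1..n}\<close>, \<open>i mod n + 1\<close> is the cyclic successor of \<open>i\<close>; \<open>one_line_rot\<close> below
  relates this to one-line notation.\<close>

definition rot :: "nat \<Rightarrow> (nat \<Rightarrow> nat) \<Rightarrow> nat \<Rightarrow> nat" where
  "rot n \<pi> = (\<lambda>i. if i \<in> {1..n} then \<pi> (i mod n + 1) else \<pi> i)"

definition one_line :: "nat \<Rightarrow> (nat \<Rightarrow> nat) \<Rightarrow> nat list" where
  "one_line n \<pi> = map \<pi> [1..<n + 1]"

definition inversions :: "nat \<Rightarrow> (nat \<Rightarrow> nat) \<Rightarrow> (nat \<times> nat) set" where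
  "inversions n \<pi> = {(i, j). i \<in> {1..n} \<and> j \<in> {1..n} \<and> i < j \<and> \<pi> j < \<pi> i}"

definition noninversions :: "nat \<Rightarrow> (nat \<Rightarrow> nat) \<Rightarrow> (nat \<times> nat) set" where
  "noninversions n \<pi> = {(i, j). i \<in> {1..n} \<and> j \<in> {1..n} \<and> i < j \<and> \<pi> i < \<pi> j}"

definition depth :: "nat \<Rightarrow> (nat \<Rightarrow> nat) \<Rightarrow> real" where
  "depth n \<pi> = (\<Sum>i\<in>{i\<in>{1..n}. \<pi> i > i}. real (\<pi> i) - real i)"

definition inversion_sum :: "nat \<Rightarrow> (nat \<Rightarrow> nat) \<Rightarrow> real" where
  "inversion_sum n \<pi> = (\<Sum>(i, j)\<in>inversions n \<pi>. real j - real i)"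

definition noninversion_sum :: "nat \<Rightarrow> (nat \<Rightarrow> nat) \<Rightarrow> real" where
  "noninversion_sum n \<pi> = (\<Sum>(i, j)\<in>noninversions n \<pi>. real j - real i)"

definition spearman_rho :: "nat \<Rightarrow> (nat \<Rightarrow> nat) \<Rightarrow> real" where
  "spearman_rho n \<pi> = (\<Sum>i\<in>{1..n}. (real (\<pi> i) - real i)\<^sup>2)"

definition total_displacement :: "nat \<Rightarrow> (nat \<Rightarrow> nat) \<Rightarrow> real" where
  "total_displacement n \<pi> = (\<Sum>i\<in>{1..n}. \<bar>real (\<pi> i) - real i\<bar>)"

lemma one_line_rot: "one_line n (rot n \<pi>) = rotate1 (one_line n \<pi>)"
proof (cases "n = 0")
  case True
  then show ?thesis by (simp add: one_line_def)
next
  case False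
  have "one_line n (rot n \<pi>) ! k = rotate1 (one_line n \<pi>) ! k" if "k < n" for k
    using that False by (simp add: one_line_def nth_rotate1 rot_def del: upt_Suc)
  then show ?thesis
    by (intro nth_equalityI) (simp_all add: one_line_def del: upt_Suc)
qed

lemma bij_betw_rot: "bij_betw (rot n) (perms n) (perms n)"
proof -
  define s :: "nat \<Rightarrow> nat" where "s = (\<lambda>i. if i \<in> {1..n} then i mod n + 1 else i)"
  have "inj_on s {1..n}"
  proof (rule inj_onI)
    fix x y assume "x \<in> {1..n}" "y \<in> {1..n}" "s x = s y"
    then show "x = y"
      by (cases "x = n"; cases "y = n") (auto simp: s_def)
  qed
  moreover have "s ` {1..n} \<subseteq> {1..n}"
    by (auto simp: s_def Suc_le_eq)
  ultimately have "bij_betw s {1..n} {1..n}"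
    by (simp add: bij_betw_def endo_inj_surj)
  then have s: "s permutes {1..n}"
    by (rule bij_imp_permutes) (auto simp: s_def)
  have rot: "rot n \<pi> = \<pi> \<circ> s" for \<pi>
    by (auto simp: rot_def s_def)
  show ?thesis
  proof (rule bij_betw_byWitness[where f' = "\<lambda>\<pi>. \<pi> \<circ> inv s"])
    show "\<forall>\<pi>\<in>perms n. rot n \<pi> \<circ> inv s = \<pi>"
      by (simp add: rot comp_assoc permutes_inv_o[OF s])
    show "\<forall>\<pi>\<in>perms n. rot n (\<pi> \<circ> inv s) = \<pi>"
      by (simp add: rot comp_assoc permutes_inv_o[OF s])
    show "rot n ` perms n \<subseteq> perms n"
      by (auto simp: rot perms_def simp del: One_nat_def intro: permutes_compose[OF s])
    show "(\<lambda>\<pi>. \<pi> \<circ> inv s) ` perms n \<subseteq> perms n"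
      by (auto simp: perms_def simp del: One_nat_def intro: permutes_compose[OF permutes_inv[OF s]])
  qed
qed

end

theory Submission imports Defs begin

text \<open>
  The \<open>n\<close> rotations \<open>rot\<^sup>m \<pi>\<close>, \<open>m < n\<close>, of a permutation \<open>\<pi>\<close> are pairwise distinct and make
  up its orbit (\<open>rot_orbit\<close>), so a statistic is homomesic with average \<open>c\<close> as soon as its values on
  them always add up to \<open>n * c\<close> (\<open>homomesic_rotI\<close>). Read cyclically, \<open>\<pi>\<close> is an \<open>n\<close>-periodic word,
  and rotating \<open>\<pi>\<close> shifts this word.

  Along an orbit each position receives each value exactly once. A statistic
  \<open>\<Sum>i. f (\<pi> i) i\<close> therefore has the orbit total \<open>\<Sum>i. \<Sum>v. f v i\<close>, which does not depend on \<open>\<pi>\<close>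
  (\<open>sum_rot_positional\<close>). This settles the depth and Spearman's rho. The total displacement is twice
  the depth, because the signed displacements \<open>\<pi> i - i\<close> of a permutation cancel.

  The inversion sum and the non-inversion sum add up to the constant
  \<open>\<Sum>i<j. (j - i) = (n + 1) choose 3\<close>, so it is enough that their difference has orbit total \<open>0\<close>.
  In that total, the \<open>n - d\<close> pairs of positions at distance \<open>d\<close> each contribute \<open>d * H d\<close>, where
  \<open>H d\<close> adds, over all cyclic positions \<open>p\<close>, a sign comparing the letters at \<open>p\<close> and \<open>p + d\<close>.
  Going around the circle the other way gives \<open>H (n - d) = - H d\<close>, while the weight \<open>d * (n - d)\<close> is
  symmetric under \<open>d \<mapsto> n - d\<close>; hence the terms cancel (\<open>sum_rot_antisymmetric\<close>).
\<close>

section \<open>Orbits of rotation\<close>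

text \<open>Positions are shifted to start at \<open>0\<close>, so that rotating \<open>\<pi>\<close> becomes adding to the index.\<close>

definition cyclic_word :: "nat \<Rightarrow> (nat \<Rightarrow> 'a) \<Rightarrow> nat \<Rightarrow> 'a" where
  "cyclic_word n \<pi> k = \<pi> (Suc (k mod n))"

lemma cyclic_word_periodic [simp]: "cyclic_word n \<pi> (k + n) = cyclic_word n \<pi> k"
  by (simp add: cyclic_word_def)

lemma rot_funpow_eq_cyclic_word:
  assumes "i < n"
  shows "(rot n ^^ m) \<pi> (Suc i) = cyclic_word n \<pi> (m + i)"
  using assms
proof (induction m arbitrary: i)
  case 0
  then show ?case by (simp add: cyclic_word_def)
next
  case (Suc m)
  have "(rot n ^^ Suc m) \<pi> (Suc i) = (rot n ^^ m) \<pi> (Suc (Suc i mod n))"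
    using Suc.prems by (simp add: rot_def)
  also have "\<dots> = cyclic_word n \<pi> (m + Suc i mod n)"
    using Suc.prems by (intro Suc.IH) simp
  also have "\<dots> = cyclic_word n \<pi> (Suc m + i)"
    by (simp add: cyclic_word_def mod_simps)
  finally show ?case .
qed

lemma rot_funpow_outside: "i \<notin> {1..n} \<Longrightarrow> (rot n ^^ m) \<pi> i = \<pi> i"
  by (induction m) (auto simp: rot_def)

lemma rot_funpow_period: "(rot n ^^ n) \<pi> = \<pi>"
proof
  fix i
  show "(rot n ^^ n) \<pi> i = \<pi> i"
  proof (cases "i \<in> {1..n}")
    case True
    then obtain k where "i = Suc k" "k < n"
      by (cases i) auto
    then show ?thesis
      by (simp add: rot_funpow_eq_cyclic_word) (simp add: cyclic_word_def)
  qed (rule rot_funpow_outside)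
qed

lemma rot_orbit: "{(rot n ^^ m) \<pi> | m. True} = (\<lambda>m. (rot n ^^ m) \<pi>) ` {..<n}" if "n \<ge> 1"
proof -
  have "(rot n ^^ m) \<pi> = (rot n ^^ (m mod n)) \<pi>" for m
    by (simp add: funpow_mod_eq rot_funpow_period)
  moreover have "m mod n < n" for m
    using that by simp
  ultimately show ?thesis
    by blast
qed

text \<open>The first letters of the rotations are the distinct letters of the word itself.\<close>

lemma inj_on_rot_funpow:
  assumes "\<pi> \<in> perms n" "n \<ge> 1"
  shows "inj_on (\<lambda>m. (rot n ^^ m) \<pi>) {..<n}"
proof (rule inj_onI)
  fix k m assume km: "k \<in> {..<n}" "m \<in> {..<n}" and eq: "(rot n ^^ k) \<pi> = (rot n ^^ m) \<pi>"
  have "(rot n ^^ k) \<pi> (Suc 0) = (rot n ^^ m) \<pi> (Suc 0)"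
    by (simp add: eq)
  then have "\<pi> (Suc k) = \<pi> (Suc m)"
    using km assms(2) by (simp add: rot_funpow_eq_cyclic_word) (simp add: cyclic_word_def)
  then show "k = m"
    using assms(1) permutes_inj[of \<pi>] by (auto simp: perms_def dest: injD)
qed

lemma homomesic_rotI:
  assumes "n \<ge> 1"
    and total: "\<And>\<pi>. \<pi> \<in> perms n \<Longrightarrow> (\<Sum>m<n. st ((rot n ^^ m) \<pi>)) = real n * c"
  shows "homomesic (rot n) (perms n) st c"
  unfolding homomesic_def orbits_def
proof (clarify)
  fix \<pi> assume \<pi>: "\<pi> \<in> perms n"
  note inj = inj_on_rot_funpow[OF \<pi> \<open>n \<ge> 1\<close>]
  show "1 / real (card {(rot n ^^ m) \<pi> | m. True}) * sum st {(rot n ^^ m) \<pi> | m. True} = c"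
    unfolding rot_orbit[OF \<open>n \<ge> 1\<close>] card_image[OF inj]
    by (subst sum.reindex[OF inj]) (use \<open>n \<ge> 1\<close> total[OF \<pi>] in \<open>simp add: o_def\<close>)
qed

lemma rot_funpow_in_perms: "\<pi> \<in> perms n \<Longrightarrow> (rot n ^^ m) \<pi> \<in> perms n"
  using bij_betwE[OF bij_betw_rot, of n] by (induction m) simp_all

section \<open>Sums over a period\<close>

lemma sum_periodic_shift:
  fixes f :: "nat \<Rightarrow> 'a :: ab_group_add"
  assumes "\<And>k. f (k + n) = f k"
  shows "(\<Sum>m<n. f (m + i)) = (\<Sum>m<n. f m)"
proof (induction i)
  case (Suc i)
  have "f i + (\<Sum>m<n. f (m + Suc i)) = (\<Sum>m<Suc n. f (m + i))"
    by (simp add: sum.lessThan_Suc_shift del: sum.lessThan_Suc)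
  also have "\<dots> = f i + (\<Sum>m<n. f (m + i))"
    using assms[of i] by (simp add: add.commute)
  finally show ?case
    using Suc by simp
qed simp

lemma sum_cyclic_word:
  assumes "\<pi> \<in> perms n"
  shows "(\<Sum>m<n. f (cyclic_word n \<pi> m)) = (\<Sum>v=1..n. f v)"
proof -
  have "(\<Sum>m<n. f (cyclic_word n \<pi> m)) = (\<Sum>m<n. f (\<pi> (Suc m)))"
    by (simp add: cyclic_word_def)
  also have "\<dots> = (\<Sum>k=1..n. f (\<pi> k))"
    by (simp add: sum.atLeast1_atMost_eq)
  also have "\<dots> = (\<Sum>v=1..n. f v)"
    using assms sum.permute[of \<pi> "{1..n}" f] by (simp add: perms_def o_def)
  finally show ?thesis .
qed

section \<open>Statistics adding up contributions of single positions\<close>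

text \<open>Over an orbit, the letter at a fixed position runs once through all values.\<close>

lemma sum_rot_positional:
  fixes f :: "nat \<Rightarrow> nat \<Rightarrow> 'a :: ab_group_add"
  assumes "\<pi> \<in> perms n"
  shows "(\<Sum>m<n. \<Sum>i=1..n. f ((rot n ^^ m) \<pi> i) i) = (\<Sum>i=1..n. \<Sum>v=1..n. f v i)"
proof -
  have "(\<Sum>m<n. f ((rot n ^^ m) \<pi> (Suc i)) (Suc i)) = (\<Sum>v=1..n. f v (Suc i))" if "i < n" for i
  proof -
    have "(\<Sum>m<n. f ((rot n ^^ m) \<pi> (Suc i)) (Suc i))
        = (\<Sum>m<n. f (cyclic_word n \<pi> (m + i)) (Suc i))"
      using that by (simp add: rot_funpow_eq_cyclic_word)
    also have "\<dots> = (\<Sum>m<n. f (cyclic_word n \<pi> m) (Suc i))"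
      by (rule sum_periodic_shift[of "\<lambda>k. f (cyclic_word n \<pi> k) (Suc i)"]) simp
    also have "\<dots> = (\<Sum>v=1..n. f v (Suc i))"
      by (rule sum_cyclic_word[OF assms])
    finally show ?thesis .
  qed
  then show ?thesis
    by (subst sum.swap) (simp add: sum.atLeast1_atMost_eq)
qed

lemma depth_altdef: "depth n \<pi> = (\<Sum>i=1..n. max 0 (real (\<pi> i) - real i))"
  unfolding depth_def by (subst sum.inter_filter) (auto intro!: sum.cong)

lemma total_displacement_eq_2_depth:
  assumes "\<pi> \<in> perms n"
  shows "total_displacement n \<pi> = 2 * depth n \<pi>"
proof -
  have "(\<Sum>i=1..n. real (\<pi> i)) = (\<Sum>i=1..n. real i)"
    using assms sum.permute[of \<pi> "{1..n}" real] by (simp add: perms_def o_def)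
  then have cancel: "(\<Sum>i=1..n. real (\<pi> i) - real i) = 0"
    by (simp add: sum_subtractf)
  have "\<bar>real (\<pi> i) - real i\<bar> = 2 * max 0 (real (\<pi> i) - real i) - (real (\<pi> i) - real i)" for i
    by (simp add: max_def abs_if)
  then have "total_displacement n \<pi>
      = 2 * depth n \<pi> - (\<Sum>i=1..n. real (\<pi> i) - real i)"
    unfolding total_displacement_def depth_altdef by (simp only: sum_subtractf sum_distrib_left)
  then show ?thesis
    using cancel by simp
qed

lemma Suc_choose_3: "real (Suc n choose 3) = (real n + 1) * real n * (real n - 1) / 6"
proof (induction n)
  case (Suc n)
  have "real (Suc n choose 2) = (real n + 1) * real n / 2"
    by (simp add: choose_two real_of_nat_div distrib_left distrib_right)
  moreover have "real (Suc (Suc n) choose 3) = real (Suc n choose 3) + real (Suc n choose 2)"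
    by (simp add: numeral_3_eq_3 numeral_2_eq_2)
  ultimately show ?case
    by (simp add: Suc.IH field_simps)
qed (simp add: numeral_3_eq_3)

lemma double_sum_Suc:
  fixes f :: "nat \<Rightarrow> nat \<Rightarrow> 'a :: comm_monoid_add"
  shows "(\<Sum>i=1..Suc n. \<Sum>v=1..Suc n. f v i)
       = (\<Sum>i=1..n. \<Sum>v=1..n. f v i) + ((\<Sum>i=1..n. f (Suc n) i) + (\<Sum>v=1..n. f v (Suc n))
         + f (Suc n) (Suc n))"
  by (simp add: sum.distrib algebra_simps)

lemma sum_real_upto: "(\<Sum>i=1..n. real i) = real n * (real n + 1) / 2"
  by (induction n) (auto simp: field_simps)

lemma sum_real_squares_upto: "(\<Sum>i=1..n. (real i)\<^sup>2) = real n * (real n + 1) * (2 * real n + 1) / 6"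
  by (induction n) (auto simp: field_simps power2_eq_square)

lemma double_sum_positive_part:
  "(\<Sum>i=1..n. \<Sum>v=1..n. max 0 (real v - real i)) = real (Suc n choose 3)"
proof (induction n)
  case (Suc n)
  have "(\<Sum>i=1..n. max 0 (real (Suc n) - real i)) = (\<Sum>i=1..n. real n + 1 - real i)"
    by (rule sum.cong) auto
  also have "\<dots> = real n * (real n + 1) / 2"
    using sum_real_upto[of n] by (simp add: sum_subtractf field_simps)
  finally have new_value: "(\<Sum>i=1..n. max 0 (real (Suc n) - real i)) = real n * (real n + 1) / 2" .
  have new_position: "(\<Sum>v=1..n. max 0 (real v - real (Suc n))) = 0"
    by (rule sum.neutral) auto
  show ?case
    unfolding double_sum_Suc Suc.IH new_value new_position unfolding Suc_choose_3
    by (simp add: field_simps)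
qed simp

lemma double_sum_squared_difference:
  "(\<Sum>i=1..n. \<Sum>v=1..n. (real v - real i)\<^sup>2) = real n * real (Suc n choose 3)"
proof -
  have "(\<Sum>i=1..n. \<Sum>v=1..n. (real v - real i)\<^sup>2)
      = (\<Sum>i=1..n. (\<Sum>v=1..n. (real v)\<^sup>2) - 2 * real i * (\<Sum>v=1..n. real v) + real n * (real i)\<^sup>2)"
    by (rule sum.cong)
       (simp_all add: power2_diff sum.distrib sum_subtractf sum_distrib_left algebra_simps)
  also have "\<dots> = 2 * real n * (\<Sum>v=1..n. (real v)\<^sup>2) - 2 * (\<Sum>v=1..n. real v)\<^sup>2"
    by (simp add: sum.distrib sum_subtractf power2_eq_square flip: sum_distrib_left sum_distrib_right)
  also have "\<dots> = real n * real (Suc n choose 3)"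
    unfolding sum_real_upto sum_real_squares_upto Suc_choose_3
    by (simp add: field_simps power2_eq_square)
  finally show ?thesis .
qed

section \<open>Statistics adding up contributions of pairs of positions\<close>

lemma sum_pairs_by_distance:
  fixes h :: "nat \<Rightarrow> 'a :: comm_semiring_1"
  shows "(\<Sum>j<n. \<Sum>i<j. h (j - i)) = (\<Sum>d=1..<n. of_nat (n - d) * h d)"
proof (induction n)
  case (Suc n)
  have "(\<Sum>i<n. h (n - i)) = (\<Sum>d=1..n. h d)"
    by (rule sum.reindex_bij_witness[of _ "\<lambda>d. n - d" "\<lambda>i. n - i"]) auto
  then have "(\<Sum>j<Suc n. \<Sum>i<j. h (j - i))
      = (\<Sum>d=1..<n. of_nat (n - d) * h d) + (\<Sum>d=1..n. h d)"
    using Suc.IH by simp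
  also have "(\<Sum>d=1..<n. of_nat (n - d) * h d) = (\<Sum>d=1..n. of_nat (n - d) * h d)"
    by (rule sum.mono_neutral_left) auto
  also have "(\<Sum>d=1..n. of_nat (n - d) * h d) + (\<Sum>d=1..n. h d)
      = (\<Sum>d=1..n. of_nat (Suc n - d) * h d)"
    by (subst sum.distrib[symmetric], rule sum.cong) (auto simp: Suc_diff_le algebra_simps)
  also have "{1..n} = {1..<Suc n}"
    by auto
  finally show ?case .
qed simp

text \<open>
  Reading the word backwards around the circle exchanges the distances \<open>d\<close> and \<open>n - d\<close> and flips the
  sign of \<open>g\<close>, but keeps the total weight \<open>d * (n - d)\<close> of a distance.
\<close>

lemma sum_rot_antisymmetric:
  fixes g :: "nat \<Rightarrow> nat \<Rightarrow> real"
  assumes antisym: "\<And>x y. g y x = - g x y"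
  shows "(\<Sum>m<n. \<Sum>j<n. \<Sum>i<j. real (j - i) *
           g ((rot n ^^ m) \<pi> (Suc i)) ((rot n ^^ m) \<pi> (Suc j))) = 0"
proof -
  define w where "w = cyclic_word n \<pi>"
  define H where "H d = (\<Sum>m<n. g (w m) (w (m + d)))" for d
  have w_periodic: "w (k + n) = w k" "w (k + n + d) = w (k + d)" for k d
    using cyclic_word_periodic[of n \<pi> k] cyclic_word_periodic[of n \<pi> "k + d"]
    by (simp_all add: w_def ac_simps)
  have H_distance: "(\<Sum>m<n. g (w (m + i)) (w (m + j))) = H (j - i)" if "i < j" for i j
  proof -
    have "(\<Sum>m<n. g (w (m + i)) (w (m + i + (j - i)))) = H (j - i)"
      unfolding H_def
      by (rule sum_periodic_shift[of "\<lambda>k. g (w k) (w (k + (j - i)))"]) (simp only: w_periodic)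
    moreover have "m + i + (j - i) = m + j" for m
      using that by simp
    ultimately show ?thesis
      by (simp only:)
  qed
  have H_antisym: "H (n - d) = - H d" if "d \<in> {1..<n}" for d
  proof -
    have "H (n - d) = (\<Sum>m<n. g (w (m + d)) (w (m + n)))"
      using H_distance[of d n] that by simp
    also have "\<dots> = (\<Sum>m<n. - g (w m) (w (m + d)))"
      unfolding w_periodic by (intro sum.cong refl antisym)
    also have "\<dots> = - H d"
      by (simp add: H_def sum_negf)
    finally show ?thesis .
  qed
  have "(\<Sum>m<n. \<Sum>j<n. \<Sum>i<j. real (j - i) *
           g ((rot n ^^ m) \<pi> (Suc i)) ((rot n ^^ m) \<pi> (Suc j)))
      = (\<Sum>m<n. \<Sum>j<n. \<Sum>i<j. real (j - i) * g (w (m + i)) (w (m + j)))"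
    by (intro sum.cong refl) (simp add: rot_funpow_eq_cyclic_word w_def)
  also have "\<dots> = (\<Sum>j<n. \<Sum>i<j. \<Sum>m<n. real (j - i) * g (w (m + i)) (w (m + j)))"
    by (subst sum.swap, rule sum.cong[OF refl], rule sum.swap)
  also have "\<dots> = (\<Sum>j<n. \<Sum>i<j. real (j - i) * H (j - i))"
    by (intro sum.cong refl) (simp add: H_distance flip: sum_distrib_left)
  also have "\<dots> = (\<Sum>d=1..<n. real (n - d) * (real d * H d))" (is "_ = ?S")
    by (rule sum_pairs_by_distance)
  finally have total: "(\<Sum>m<n. \<Sum>j<n. \<Sum>i<j. real (j - i) *
           g ((rot n ^^ m) \<pi> (Suc i)) ((rot n ^^ m) \<pi> (Suc j))) = ?S" .
  have "?S = (\<Sum>d=1..<n. real d * (real (n - d) * H (n - d)))"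
    by (rule sum.reindex_bij_witness[of _ "\<lambda>d. n - d" "\<lambda>d. n - d"]) auto
  also have "\<dots> = (\<Sum>d=1..<n. - (real (n - d) * (real d * H d)))"
    by (rule sum.cong) (simp_all add: H_antisym)
  also have "\<dots> = - ?S"
    by (rule sum_negf)
  finally have "?S = 0"
    by simp
  with total show ?thesis
    by simp
qed

lemma sum_ordered_pairs_filter:
  "(\<Sum>(i, j)\<in>{(i, j). i \<in> {1..n} \<and> j \<in> {1..n} \<and> i < j \<and> P i j}. real j - real i)
    = (\<Sum>j<n. \<Sum>i<j. real (j - i) * of_bool (P (Suc i) (Suc j)))" (is "sum ?f ?A = _")
proof -
  have "(\<Sum>j<n. \<Sum>i<j. real (j - i) * of_bool (P (Suc i) (Suc j)))
      = (\<Sum>(j, i)\<in>(SIGMA j:{..<n}. {..<j}). real (j - i) * of_bool (P (Suc i) (Suc j)))"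
    by (rule sum.Sigma) auto
  also have "\<dots> = (\<Sum>(j, i)\<in>{(j, i). i < j \<and> j < n \<and> P (Suc i) (Suc j)}. real (j - i))"
    by (rule sum.mono_neutral_cong_right) (auto intro: finite_subset)
  also have "\<dots> = sum ?f ?A"
    by (rule sum.reindex_bij_witness
          [of _ "\<lambda>(i, j). (j - 1, i - 1)" "\<lambda>(j, i). (Suc i, Suc j)"]) auto
  finally show ?thesis ..
qed

lemma inversion_sum_add_noninversion_sum:
  assumes "\<pi> \<in> perms n"
  shows "inversion_sum n \<pi> + noninversion_sum n \<pi> = real (Suc n choose 3)"
proof -
  have "inj \<pi>"
    using assms permutes_inj by (auto simp: perms_def)
  then have cases: "of_bool (\<pi> (Suc j) < \<pi> (Suc i)) + of_bool (\<pi> (Suc i) < \<pi> (Suc j)) = (1::real)"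
    if "i < j" for i j
    using that by (cases "\<pi> (Suc i)" "\<pi> (Suc j)" rule: linorder_cases) (auto dest: injD)
  have "inversion_sum n \<pi> + noninversion_sum n \<pi>
      = (\<Sum>j<n. \<Sum>i<j. real (j - i) *
          (of_bool (\<pi> (Suc j) < \<pi> (Suc i)) + of_bool (\<pi> (Suc i) < \<pi> (Suc j))))"
    unfolding inversion_sum_def noninversion_sum_def inversions_def noninversions_def
      sum_ordered_pairs_filter by (simp add: distrib_left sum.distrib)
  also have "\<dots> = (\<Sum>j<n. \<Sum>i<j. real (j - i))"
    by (intro sum.cong refl) (simp add: cases)
  also have "\<dots> = real (Suc n choose 3)"
  proof (induction n)
    case (Suc n)
    have "(\<Sum>i<n. real (n - i)) = (\<Sum>d=1..n. real d)"
      by (rule sum.reindex_bij_witness[of _ "\<lambda>d. n - d" "\<lambda>i. n - i"]) auto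
    then have "(\<Sum>i<n. real (n - i)) = real n * (real n + 1) / 2"
      by (simp only: sum_real_upto)
    then have "(\<Sum>j<Suc n. \<Sum>i<j. real (j - i))
        = real (Suc n choose 3) + real n * (real n + 1) / 2"
      using Suc.IH by simp
    then show ?case
      unfolding Suc_choose_3 by (simp add: field_simps)
  qed simp
  finally show ?thesis .
qed

lemma inversion_sum_minus_noninversion_sum:
  "inversion_sum n \<pi> - noninversion_sum n \<pi>
    = (\<Sum>j<n. \<Sum>i<j. real (j - i) *
        (of_bool (\<pi> (Suc j) < \<pi> (Suc i)) - of_bool (\<pi> (Suc i) < \<pi> (Suc j))))"
  unfolding inversion_sum_def noninversion_sum_def inversions_def noninversions_def
    sum_ordered_pairs_filter by (simp add: right_diff_distrib sum_subtractf)

lemma sum_rot_inversion_noninversion: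
  assumes "\<pi> \<in> perms n"
  shows "(\<Sum>m<n. inversion_sum n ((rot n ^^ m) \<pi>)) = real n * (1 / 2 * real (Suc n choose 3))"
    and "(\<Sum>m<n. noninversion_sum n ((rot n ^^ m) \<pi>)) = real n * (1 / 2 * real (Suc n choose 3))"
proof -
  define I where "I = (\<Sum>m<n. inversion_sum n ((rot n ^^ m) \<pi>))"
  define N where "N = (\<Sum>m<n. noninversion_sum n ((rot n ^^ m) \<pi>))"
  have "I + N = real n * real (Suc n choose 3)"
    unfolding I_def N_def sum.distrib[symmetric]
    by (simp add: inversion_sum_add_noninversion_sum rot_funpow_in_perms assms)
  moreover have "I - N = 0"
    unfolding I_def N_def sum_subtractf[symmetric] inversion_sum_minus_noninversion_sum
    by (rule sum_rot_antisymmetric[of "\<lambda>x y. of_bool (y < x) - of_bool (x < y)"]) simp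
  ultimately show "I = real n * (1 / 2 * real (Suc n choose 3))"
    and "N = real n * (1 / 2 * real (Suc n choose 3))"
    by simp_all
qed

section \<open>The five homomesies\<close>

theorem theorem2p7:
  fixes n :: nat
  assumes "n \<ge> 1"
  shows "homomesic (rot n) (perms n) (depth n) (1 / real n * real ((n + 1) choose 3))
    \<and> homomesic (rot n) (perms n) (inversion_sum n) (1 / 2 * real ((n + 1) choose 3))
    \<and> homomesic (rot n) (perms n) (noninversion_sum n) (1 / 2 * real ((n + 1) choose 3))
    \<and> homomesic (rot n) (perms n) (spearman_rho n) (real ((n + 1) choose 3))
    \<and> homomesic (rot n) (perms n) (total_displacement n) (2 / real n * real ((n + 1) choose 3))"
proof -
  have depth_total: "(\<Sum>m<n. depth n ((rot n ^^ m) \<pi>)) = real (Suc n choose 3)"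
    if "\<pi> \<in> perms n" for \<pi>
    unfolding depth_altdef double_sum_positive_part[symmetric]
    by (rule sum_rot_positional[OF that, of "\<lambda>v i. max 0 (real v - real i)"])
  have rho_total: "(\<Sum>m<n. spearman_rho n ((rot n ^^ m) \<pi>)) = real n * real (Suc n choose 3)"
    if "\<pi> \<in> perms n" for \<pi>
    unfolding spearman_rho_def double_sum_squared_difference[symmetric]
    by (rule sum_rot_positional[OF that, of "\<lambda>v i. (real v - real i)\<^sup>2"])
  have displacement_total:
    "(\<Sum>m<n. total_displacement n ((rot n ^^ m) \<pi>)) = 2 * real (Suc n choose 3)"
    if "\<pi> \<in> perms n" for \<pi>
    using depth_total[OF that] that
    by (simp add: total_displacement_eq_2_depth rot_funpow_in_perms flip: sum_distrib_left)
  show ?thesis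
    using assms depth_total rho_total displacement_total sum_rot_inversion_noninversion
    by (intro conjI homomesic_rotI) simp_all
qed

end
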